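(* There exists a constant $c_1 > 0$ such that, for all positive integers $n$, there exist integers $1 \leq a_1 < \ldots < a_k \leq n$ (for some $k$) such that there are at least $c_1 n^2$ distinct integers of the form $\sum_{i=u}^{v} a_i$ with $1 \leq u \leq v \leq k$. *)

theory Defs
  imports Complex_Main
begin

end

theory Submission
  imports Defs "HOL-Analysis.Convex"
begin

text \<open>
  The partial sums \<open>i\<^sup>2\<close> almost work, but their differences form a multiplication table and so
  collide too often. We perturb them to \<open>P i = i\<^sup>2 + \<lfloor>j i / N\<rfloor>\<close> with \<open>N\<close> of order \<open>n\<close> and average
  over \<open>0 \<le> j < N\<close>. With \<open>l = v - u\<close> and \<open>x = u + v\<close>, a collision \<open>P v - P u = P v' - P u'\<close>
  forces \<open>\<bar>N l (x - x') + (l - l') (N x' + j)\<bar> < 2 N\<close>. For fixed \<open>l \<noteq> l'\<close> of order \<open>N\<close> this leaves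
  \<open>O(\<bar>l - l'\<bar>)\<close> values of \<open>x - x'\<close> and, for each of them, \<open>O(N / \<bar>l - l'\<bar>)\<close> values of \<open>N x' + j\<close>,
  which encodes both \<open>x'\<close> and \<open>j\<close>. Hence some \<open>j\<close> has only \<open>O(N\<^sup>2)\<close> collisions among \<open>N\<^sup>2\<close> pairs
  \<open>(u, v)\<close>, and the Cauchy-Schwarz inequality gives a positive proportion of \<open>N\<^sup>2\<close> distinct differences.
\<close>

definition collisions :: "('a \<Rightarrow> 'b) \<Rightarrow> 'a set \<Rightarrow> ('a \<times> 'a) set" where
  "collisions f A = {(x, y). x \<in> A \<and> y \<in> A \<and> f x = f y}"

lemma finite_collisions: "finite A \<Longrightarrow> finite (collisions f A)"
  by (rule finite_subset[of _ "A \<times> A"]) (auto simp: collisions_def)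

lemma card_collisions:
  assumes "finite A"
  shows "card (collisions f A) = (\<Sum>y\<in>f ` A. (card {x \<in> A. f x = y})\<^sup>2)"
proof -
  have "collisions f A = (\<Union>y\<in>f ` A. {x \<in> A. f x = y} \<times> {x \<in> A. f x = y})"
    by (auto simp: collisions_def)
  also have "card \<dots> = (\<Sum>y\<in>f ` A. card ({x \<in> A. f x = y} \<times> {x \<in> A. f x = y}))"
    using assms by (intro card_UN_disjoint) auto
  finally show ?thesis by (simp add: card_cartesian_product power2_eq_square)
qed

lemma card_square_le_card_image_mult_card_collisions:
  fixes f :: "'a \<Rightarrow> 'b"
  assumes "finite A"
  shows "(card A)\<^sup>2 \<le> card (f ` A) * card (collisions f A)"
proof -
  define fibre_card where "fibre_card y = card {x \<in> A. f x = y}" for y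
  have "card A = (\<Sum>y\<in>f ` A. fibre_card y)"
    using sum.image_gen[OF assms, of "\<lambda>_. 1 :: nat" f] by (simp add: fibre_card_def)
  then have "real ((card A)\<^sup>2) = (\<Sum>y\<in>f ` A. real (fibre_card y))\<^sup>2" by simp
  also have "\<dots> \<le> (\<Sum>y\<in>f ` A. (real (fibre_card y))\<^sup>2) * card (f ` A)"
    by (rule sum_squared_le_sum_of_squares)
  also have "\<dots> = real (card (f ` A) * card (collisions f A))"
    by (simp add: card_collisions[OF assms] fibre_card_def)
  finally show ?thesis unfolding of_nat_le_iff .
qed

lemma exists_large_image_of_few_collisions:
  fixes F :: "'i \<Rightarrow> 'a \<Rightarrow> 'b"
  assumes "finite J" "J \<noteq> {}" "finite A"
    and few: "(\<Sum>j\<in>J. card (collisions (F j) A)) \<le> card J * C"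
  obtains j where "j \<in> J" "(card A)\<^sup>2 \<le> card (F j ` A) * C"
proof -
  have "\<exists>j\<in>J. card (collisions (F j) A) \<le> C"
  proof (rule ccontr)
    assume "\<not> ?thesis"
    then have "(\<Sum>j\<in>J. C) < (\<Sum>j\<in>J. card (collisions (F j) A))"
      using assms by (intro sum_strict_mono) auto
    with few show False by simp
  qed
  then obtain j where j: "j \<in> J" "card (collisions (F j) A) \<le> C" by blast
  have "(card A)\<^sup>2 \<le> card (F j ` A) * card (collisions (F j) A)"
    using \<open>finite A\<close> by (rule card_square_le_card_image_mult_card_collisions)
  also have "\<dots> \<le> card (F j ` A) * C" using j by simp
  finally show thesis using that j by blast
qed

lemma card_int_set_diff_le:
  fixes Y :: "int set"
  assumes "0 \<le> D" and diff: "\<And>x y. x \<in> Y \<Longrightarrow> y \<in> Y \<Longrightarrow> y - x \<le> D"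
  shows "finite Y" and "int (card Y) \<le> D + 1"
proof -
  have "finite Y \<and> int (card Y) \<le> D + 1"
  proof (cases "Y = {}")
    case False
    then obtain z where "z \<in> Y" by blast
    then have "Y \<subseteq> {z - D..z + D}" using diff by force
    then have fin: "finite Y" by (rule finite_subset) simp
    have "Y \<subseteq> {Min Y..Min Y + D}"
    proof
      fix y assume "y \<in> Y"
      then show "y \<in> {Min Y..Min Y + D}" using fin False diff[of "Min Y" y] Min_in[of Y] by auto
    qed
    then have "card Y \<le> card {Min Y..Min Y + D}" by (rule card_mono[rotated]) simp
    then show ?thesis using fin \<open>0 \<le> D\<close> by simp
  qed (use \<open>0 \<le> D\<close> in simp)
  then show "finite Y" "int (card Y) \<le> D + 1" by auto
qed

lemma card_int_affine_abs_less:
  fixes b c d :: int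
  assumes "d \<noteq> 0" "0 \<le> b"
  shows "finite {y. \<bar>c + d * y\<bar> < b}"
    and "\<bar>d\<bar> * int (card {y. \<bar>c + d * y\<bar> < b}) \<le> 2 * b + \<bar>d\<bar>"
proof -
  define Y D where "Y = {y. \<bar>c + d * y\<bar> < b}" and "D = 2 * b div \<bar>d\<bar>"
  have "y - x \<le> D" if "x \<in> Y" "y \<in> Y" for x y
  proof -
    have "(y - x) * \<bar>d\<bar> \<le> \<bar>y - x\<bar> * \<bar>d\<bar>" by (intro mult_right_mono) auto
    also have "\<dots> = \<bar>(y - x) * d\<bar>" by (simp add: abs_mult)
    also have "(y - x) * d = (c + d * y) - (c + d * x)" by (simp add: algebra_simps)
    also have "\<bar>\<dots>\<bar> \<le> 2 * b" using that by (simp add: Y_def)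
    finally have "(y - x) * \<bar>d\<bar> div \<bar>d\<bar> \<le> D"
      unfolding D_def using assms by (intro zdiv_mono1) auto
    then show ?thesis using assms by simp
  qed
  moreover have "0 \<le> D" using assms by (simp add: D_def pos_imp_zdiv_nonneg_iff)
  ultimately have fin: "finite Y" and card: "int (card Y) \<le> D + 1"
    using card_int_set_diff_le[of D Y] by blast+
  from fin show "finite {y. \<bar>c + d * y\<bar> < b}" by (simp add: Y_def)
  have "\<bar>d\<bar> * int (card Y) \<le> \<bar>d\<bar> * (D + 1)" using card by (intro mult_left_mono) auto
  also have "\<dots> = 2 * b - 2 * b mod \<bar>d\<bar> + \<bar>d\<bar>"
    by (simp add: D_def distrib_left minus_mod_eq_mult_div)
  also have "\<dots> \<le> 2 * b + \<bar>d\<bar>" using assms by simp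
  finally show "\<bar>d\<bar> * int (card {y. \<bar>c + d * y\<bar> < b}) \<le> 2 * b + \<bar>d\<bar>" by (simp add: Y_def)
qed

definition lattice_strip :: "int \<Rightarrow> int \<Rightarrow> int \<Rightarrow> int \<Rightarrow> (int \<times> int) set" where
  "lattice_strip r m d b = {(x, y). \<bar>x\<bar> \<le> r \<and> \<bar>m * x + d * y\<bar> < b}"

lemma card_lattice_strip:
  assumes "d \<noteq> 0" "0 \<le> b" "0 \<le> r"
  shows "finite (lattice_strip r m d b)"
    and "\<bar>d\<bar> * int (card (lattice_strip r m d b)) \<le> (2 * r + 1) * (2 * b + \<bar>d\<bar>)"
proof -
  define Y where "Y x = {y. \<bar>m * x + d * y\<bar> < b}" for x
  have strip: "lattice_strip r m d b = Sigma {- r..r} Y"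
    by (auto simp: lattice_strip_def Y_def abs_le_iff)
  have fin: "finite (Y x)" and card: "\<bar>d\<bar> * int (card (Y x)) \<le> 2 * b + \<bar>d\<bar>" for x
    using card_int_affine_abs_less[OF assms(1,2)] by (simp_all add: Y_def)
  show "finite (lattice_strip r m d b)" using fin by (simp add: strip)
  have "\<bar>d\<bar> * int (card (lattice_strip r m d b)) = (\<Sum>x\<in>{- r..r}. \<bar>d\<bar> * int (card (Y x)))"
    using fin by (simp add: strip sum_distrib_left)
  also have "\<dots> \<le> (\<Sum>x\<in>{- r..r}. 2 * b + \<bar>d\<bar>)" using card by (rule sum_mono)
  finally show "\<bar>d\<bar> * int (card (lattice_strip r m d b)) \<le> (2 * r + 1) * (2 * b + \<bar>d\<bar>)"
    using \<open>0 \<le> r\<close> by simp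
qed

definition perturbed_square :: "nat \<Rightarrow> nat \<Rightarrow> nat \<Rightarrow> nat" where
  "perturbed_square N j i = i\<^sup>2 + j * i div N"

lemma perturbed_square_Suc:
  assumes "0 < N" "j \<le> N"
  shows "perturbed_square N j (Suc i) \<in>
    {perturbed_square N j i + 2 * i + 1..perturbed_square N j i + 2 * i + 2}"
proof -
  have "j * i div N \<le> j * Suc i div N" by (intro div_le_mono) simp
  moreover have "j * Suc i div N \<le> (j * i + N) div N"
    using assms by (intro div_le_mono) simp
  then have "j * Suc i div N \<le> j * i div N + 1" using assms by simp
  ultimately show ?thesis by (simp add: perturbed_square_def power2_eq_square)
qed

text \<open>The pair \<open>(u, l)\<close> stands for the block of indices \<open>u + 1, \<dots>, u + l\<close>.\<close>

definition block_sum :: "nat \<Rightarrow> nat \<Rightarrow> nat \<times> nat \<Rightarrow> int" where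
  "block_sum N j = (\<lambda>(u, l). int (perturbed_square N j (u + l)) - int (perturbed_square N j u))"

lemma block_sum_approx:
  assumes "0 < N"
  shows "\<bar>int N * block_sum N j (u, l) - int (l * (N * (2 * u + l) + j))\<bar> < int N"
proof -
  have N_mult_perturbed_square:
    "int N * int (perturbed_square N j i) = int (N * i\<^sup>2 + j * i) - int (j * i mod N)" for i
  proof -
    have "N * perturbed_square N j i + j * i mod N = N * i\<^sup>2 + j * i"
      by (simp add: perturbed_square_def distrib_left)
    then show ?thesis by (metis add_diff_cancel_right' of_nat_add of_nat_mult)
  qed
  have "int N * block_sum N j (u, l) - int (l * (N * (2 * u + l) + j))
      = int (j * u mod N) - int (j * (u + l) mod N)"
    by (simp add: block_sum_def right_diff_distrib N_mult_perturbed_square)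
      (simp add: algebra_simps power2_eq_square)
  moreover have "j * u mod N < N" "j * (u + l) mod N < N" using assms by simp_all
  ultimately show ?thesis by linarith
qed

lemma block_sum_collision:
  assumes "0 < N" "block_sum N j (u, l) = block_sum N j (u', l')"
  shows "\<bar>int N * int l * (int (2 * u + l) - int (2 * u' + l'))
    + (int l - int l') * int (N * (2 * u' + l') + j)\<bar> < 2 * int N"
proof -
  have "int N * int l * (int (2 * u + l) - int (2 * u' + l'))
      + (int l - int l') * int (N * (2 * u' + l') + j)
      = int (l * (N * (2 * u + l) + j)) - int (l' * (N * (2 * u' + l') + j))"
    by (simp add: algebra_simps)
  then show ?thesis
    using block_sum_approx[OF assms(1), of j u l] block_sum_approx[OF assms(1), of j u' l']
    unfolding assms(2) by linarith
qed

lemma inj_block_sum: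
  assumes "0 < N" "0 < l"
  shows "inj (\<lambda>u. block_sum N j (u, l))"
proof (rule injI)
  fix u u' assume "block_sum N j (u, l) = block_sum N j (u', l)"
  from block_sum_collision[OF assms(1) this]
  have "\<bar>int N * (int l * (2 * (int u - int u')))\<bar> < 2 * int N"
    by (simp add: algebra_simps)
  then have "int N * (int l * \<bar>int u - int u'\<bar>) < int N * 1"
    by (simp add: abs_mult del: right_diff_distrib_numeral mult_less_cancel_left_pos)
  then have "int l * \<bar>int u - int u'\<bar> < 1"
    using assms by (simp only: mult_less_cancel_left_pos of_nat_0_less_iff)
  then show "u = u'"
    using assms mult_pos_pos[of "int l" "\<bar>int u - int u'\<bar>"] by linarith
qed

definition block_collisions :: "nat \<Rightarrow> nat \<Rightarrow> nat \<Rightarrow> (nat \<times> nat \<times> nat) set" where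
  "block_collisions N l l' = {(j, u, u'). j < N \<and> u < N \<and> u' < N \<and>
     block_sum N j (u, l) = block_sum N j (u', l')}"

lemma finite_block_collisions: "finite (block_collisions N l l')"
  by (rule finite_subset[of _ "{..<N} \<times> {..<N} \<times> {..<N}"]) (auto simp: block_collisions_def)

lemma card_block_collisions_same_length:
  assumes "0 < N" "0 < l"
  shows "card (block_collisions N l l) \<le> N\<^sup>2"
proof -
  have "block_collisions N l l \<subseteq> (\<lambda>(j, u). (j, u, u)) ` ({..<N} \<times> {..<N})"
  proof clarify
    fix j u u' assume collision: "(j, u, u') \<in> block_collisions N l l"
    then have "u = u'"
      by (intro injD[OF inj_block_sum[OF assms, of j]]) (simp add: block_collisions_def)
    then show "(j, u, u') \<in> (\<lambda>(j, u). (j, u, u)) ` ({..<N} \<times> {..<N})"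
      using collision by (auto simp: block_collisions_def)
  qed
  then have "card (block_collisions N l l) \<le> card ({..<N} \<times> {..<N})"
    by (rule surj_card_le[rotated]) simp
  then show ?thesis by (simp add: card_cartesian_product power2_eq_square)
qed

definition collision_code :: "nat \<Rightarrow> nat \<Rightarrow> nat \<Rightarrow> nat \<times> nat \<times> nat \<Rightarrow> int \<times> int" where
  "collision_code N l l' =
     (\<lambda>(j, u, u'). (int (2 * u + l) - int (2 * u' + l'), int (N * (2 * u' + l') + j)))"

lemma inj_on_collision_code: "inj_on (collision_code N l l') (block_collisions N l l')"
proof (rule inj_onI)
  fix w z
  assume "w \<in> block_collisions N l l'" "z \<in> block_collisions N l l'"
    and code: "collision_code N l l' w = collision_code N l l' z"
  moreover obtain j u u' i t t' where wz: "w = (j, u, u')" "z = (i, t, t')"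
    by (cases w, cases z)
  ultimately have "j < N" "i < N" by (simp_all add: wz block_collisions_def)
  from code have eq: "N * (2 * u' + l') + j = N * (2 * t' + l') + i"
    unfolding collision_code_def
    by (simp only: wz prod.case prod.inject of_nat_eq_iff)
  then have "(N * (2 * u' + l') + j) mod N = (N * (2 * t' + l') + i) mod N" by simp
  then have "j = i" using \<open>j < N\<close> \<open>i < N\<close> by simp
  moreover from this have "u' = t'" using eq \<open>j < N\<close> by simp
  moreover from this have "u = t" using code by (simp add: wz collision_code_def)
  ultimately show "w = z" by (simp add: wz)
qed

lemma abs_le_of_abs_affine_less:
  fixes N l d e y C :: int
  assumes "0 < N" "N \<le> l" "d \<noteq> 0" "\<bar>y\<bar> \<le> C * N\<^sup>2" "\<bar>N * l * e + d * y\<bar> < 2 * N"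
  shows "\<bar>e\<bar> \<le> (C + 2) * \<bar>d\<bar>"
proof -
  have "N\<^sup>2 * \<bar>e\<bar> \<le> (N * l) * \<bar>e\<bar>"
    using assms by (intro mult_right_mono) (auto simp: power2_eq_square)
  also have "\<dots> = \<bar>N * l * e\<bar>" using assms by (simp add: abs_mult)
  also have "\<dots> \<le> 2 * N + \<bar>d * y\<bar>" using assms(5) by linarith
  also have "\<dots> \<le> 2 * (\<bar>d\<bar> * N\<^sup>2) + \<bar>d\<bar> * (C * N\<^sup>2)"
  proof -
    have "1 * N \<le> \<bar>d\<bar> * N\<^sup>2"
      using assms by (intro mult_mono) (auto simp: power2_eq_square)
    moreover have "\<bar>d * y\<bar> \<le> \<bar>d\<bar> * (C * N\<^sup>2)"
      unfolding abs_mult using assms(4) by (rule mult_left_mono) simp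
    ultimately show ?thesis by linarith
  qed
  also have "\<dots> = N\<^sup>2 * ((C + 2) * \<bar>d\<bar>)" by (simp add: algebra_simps)
  finally show ?thesis using assms(1) by (simp only: mult_le_cancel_left_pos zero_less_power)
qed

lemma collision_code_image_subset_lattice_strip:
  assumes "l \<in> {N..<2 * N}" "l' \<in> {N..<2 * N}" "l \<noteq> l'"
  shows "collision_code N l l' ` block_collisions N l l' \<subseteq>
    lattice_strip (6 * \<bar>int l - int l'\<bar>) (int N * int l) (int l - int l') (2 * int N)"
proof (rule image_subsetI, clarify)
  fix j u u' assume collision: "(j, u, u') \<in> block_collisions N l l'"
  define e y where "e = int (2 * u + l) - int (2 * u' + l')" and "y = N * (2 * u' + l') + j"
  have small: "\<bar>int N * int l * e + (int l - int l') * int y\<bar> < 2 * int N"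
    unfolding e_def y_def
    using collision assms by (intro block_sum_collision) (auto simp: block_collisions_def)
  have "y \<le> N * (2 * u' + l' + 1)" using collision by (simp add: y_def block_collisions_def)
  also have "\<dots> \<le> N * (4 * N)"
    using collision assms by (intro mult_left_mono) (auto simp: block_collisions_def)
  finally have "y \<le> 4 * N\<^sup>2" by (simp add: power2_eq_square)
  then have "int y \<le> int (4 * N\<^sup>2)" by (simp only: of_nat_le_iff)
  then have "\<bar>e\<bar> \<le> 6 * \<bar>int l - int l'\<bar>"
    using small assms abs_le_of_abs_affine_less[of "int N" "int l" _ "int y" 4] by simp
  then show "collision_code N l l' (j, u, u') \<in>
    lattice_strip (6 * \<bar>int l - int l'\<bar>) (int N * int l) (int l - int l') (2 * int N)"
    using small unfolding lattice_strip_def collision_code_def e_def y_def by simp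
qed

lemma card_block_collisions_distinct_lengths:
  assumes "l \<in> {N..<2 * N}" "l' \<in> {N..<2 * N}" "l \<noteq> l'"
  shows "card (block_collisions N l l') \<le> 65 * N"
proof -
  define d where "d = int l - int l'"
  define strip where "strip = lattice_strip (6 * \<bar>d\<bar>) (int N * int l) d (2 * int N)"
  have d: "d \<noteq> 0" "1 \<le> \<bar>d\<bar>" "\<bar>d\<bar> \<le> int N" using assms by (auto simp: d_def)
  have strip: "finite strip"
    "\<bar>d\<bar> * int (card strip) \<le> (2 * (6 * \<bar>d\<bar>) + 1) * (2 * (2 * int N) + \<bar>d\<bar>)"
    unfolding strip_def by (rule card_lattice_strip; use d in simp)+
  have "card (block_collisions N l l') \<le> card strip"
    using inj_on_collision_code collision_code_image_subset_lattice_strip[OF assms] strip(1)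
    unfolding strip_def d_def by (rule card_inj_on_le)
  then have "\<bar>d\<bar> * int (card (block_collisions N l l')) \<le> \<bar>d\<bar> * int (card strip)"
    by (intro mult_left_mono) auto
  also note strip(2)
  also have "(2 * (6 * \<bar>d\<bar>) + 1) * (2 * (2 * int N) + \<bar>d\<bar>) \<le> (13 * \<bar>d\<bar>) * (5 * int N)"
    using d by (intro mult_mono) auto
  also have "\<dots> = \<bar>d\<bar> * int (65 * N)" by simp
  finally show ?thesis using d by (simp only: mult_le_cancel_left_pos of_nat_le_iff)
qed

lemma sum_card_collisions_block_sum:
  assumes "finite L"
  shows "(\<Sum>j<N. card (collisions (block_sum N j) ({..<N} \<times> L))) =
    (\<Sum>l\<in>L. \<Sum>l'\<in>L. card (block_collisions N l l'))"
proof -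
  have "bij_betw (\<lambda>(j, (u, l), (u', l')). (l, l', j, u, u'))
      (SIGMA j:{..<N}. collisions (block_sum N j) ({..<N} \<times> L))
      (SIGMA l:L. SIGMA l':L. block_collisions N l l')"
    by (rule bij_betw_byWitness[where f' = "\<lambda>(l, l', j, u, u'). (j, (u, l), (u', l'))"])
      (auto simp: collisions_def block_collisions_def)
  then have "card (SIGMA j:{..<N}. collisions (block_sum N j) ({..<N} \<times> L)) =
      card (SIGMA l:L. SIGMA l':L. block_collisions N l l')"
    by (rule bij_betw_same_card)
  then show ?thesis using assms by (simp add: finite_collisions finite_block_collisions)
qed

definition blocks :: "nat \<Rightarrow> (nat \<times> nat) set" where
  "blocks N = {..<N} \<times> {N..<2 * N}"

lemma finite_blocks: "finite (blocks N)"
  by (simp add: blocks_def)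

lemma card_blocks: "card (blocks N) = N\<^sup>2"
  by (simp add: blocks_def card_cartesian_product power2_eq_square)

lemma sum_card_collisions_block_sum_le:
  assumes "0 < N"
  shows "(\<Sum>j<N. card (collisions (block_sum N j) (blocks N))) \<le> N * (66 * N\<^sup>2)"
proof -
  let ?L = "{N..<2 * N}"
  have "(\<Sum>j<N. card (collisions (block_sum N j) (blocks N)))
      = (\<Sum>l\<in>?L. \<Sum>l'\<in>?L. card (block_collisions N l l'))"
    by (simp add: blocks_def sum_card_collisions_block_sum)
  also have "\<dots> \<le> (\<Sum>l\<in>?L. \<Sum>l'\<in>?L. (if l' = l then N\<^sup>2 else 0) + 65 * N)"
  proof (intro sum_mono)
    fix l l' assume "l \<in> ?L" "l' \<in> ?L"
    then show "card (block_collisions N l l') \<le> (if l' = l then N\<^sup>2 else 0) + 65 * N"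
      using card_block_collisions_same_length[of N l]
        card_block_collisions_distinct_lengths[of l N l'] assms by auto
  qed
  also have "\<dots> = N * (66 * N\<^sup>2)"
    by (simp add: sum.distrib power2_eq_square)
  finally show ?thesis .
qed

lemma exists_many_block_sums:
  assumes "0 < N"
  obtains j where "j < N" "N\<^sup>2 \<le> 66 * card (block_sum N j ` blocks N)"
proof -
  obtain j where "j \<in> {..<N}"
    and "(card (blocks N))\<^sup>2
      \<le> card (block_sum N j ` blocks N) * (66 * N\<^sup>2)"
    using exists_large_image_of_few_collisions[of "{..<N}" "blocks N" "block_sum N"]
      sum_card_collisions_block_sum_le[OF assms] assms
    by (auto simp: finite_blocks)
  then have "N\<^sup>2 * N\<^sup>2 \<le> N\<^sup>2 * (66 * card (block_sum N j ` blocks N))"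
    by (simp add: card_blocks mult_ac flip: power_add power2_eq_square)
  then have "N\<^sup>2 \<le> 66 * card (block_sum N j ` blocks N)"
    using assms by (simp only: nat_mult_le_cancel1 zero_less_power)
  then show thesis using that \<open>j \<in> {..<N}\<close> by simp
qed

definition consecutive_sums :: "(nat \<Rightarrow> 'a::comm_monoid_add) \<Rightarrow> nat \<Rightarrow> 'a set" where
  "consecutive_sums a k = {\<Sum>i = u..v. a i | u v. 1 \<le> u \<and> u \<le> v \<and> v \<le> k}"

lemma finite_consecutive_sums: "finite (consecutive_sums a k)"
  by (rule finite_subset[of _ "(\<lambda>(u, v). \<Sum>i = u..v. a i) ` ({..k} \<times> {..k})"])
    (auto simp: consecutive_sums_def)

lemma consecutive_sums_Suc_0: "consecutive_sums a (Suc 0) = {a (Suc 0)}"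
proof -
  have "Suc 0 \<le> u \<and> u \<le> v \<and> v \<le> Suc 0 \<longleftrightarrow> u = Suc 0 \<and> v = Suc 0" for u v by auto
  then show ?thesis by (simp add: consecutive_sums_def)
qed

lemma diff_in_consecutive_sums:
  fixes p :: "nat \<Rightarrow> 'a::ab_group_add"
  assumes "u < v" "v \<le> k"
  shows "p v - p u \<in> consecutive_sums (\<lambda>i. p i - p (i - 1)) k"
proof -
  have "p v - p u = (\<Sum>i = Suc u..v. p i - p (i - 1))"
    using assms sum_telescope''[of u v p] by simp
  then show ?thesis
    unfolding consecutive_sums_def mem_Collect_eq using assms
    by (intro exI[of _ "Suc u"] exI[of _ v]) simp
qed

lemma exists_sequence_many_consecutive_sums:
  assumes "0 < N"
  obtains a :: "nat \<Rightarrow> int" where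
    "strict_mono a" "\<And>i. i \<in> {1..3 * N} \<Longrightarrow> a i \<in> {1..6 * int N}"
    "N\<^sup>2 \<le> 66 * card (consecutive_sums a (3 * N))"
proof -
  obtain j where "j < N"
    and many: "N\<^sup>2 \<le> 66 * card (block_sum N j ` blocks N)"
    using exists_many_block_sums[OF assms] .
  define p where "p i = int (perturbed_square N j i)" for i
  define a where "a = (\<lambda>i. p i - p (i - 1))"
  have a_0: "a 0 = 0" by (simp add: a_def)
  have a_Suc: "a (Suc i) \<in> {2 * int i + 1..2 * int i + 2}" for i
    using perturbed_square_Suc[OF assms, of j i] \<open>j < N\<close> by (auto simp: a_def p_def)
  have "a i < a (Suc i)" for i
    using a_0 a_Suc[of i] a_Suc[of "i - 1"] by (cases i) auto
  then have "strict_mono a" by (simp add: strict_mono_Suc_iff)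
  moreover have "a i \<in> {1..6 * int N}" if "i \<in> {1..3 * N}" for i
    using that a_Suc[of "i - 1"] by (cases i) auto
  moreover have "block_sum N j ` blocks N \<subseteq> consecutive_sums a (3 * N)"
  proof (rule image_subsetI, clarify)
    fix u l assume "(u, l) \<in> blocks N"
    then have "p (u + l) - p u \<in> consecutive_sums a (3 * N)"
      unfolding a_def by (intro diff_in_consecutive_sums) (auto simp: blocks_def)
    then show "block_sum N j (u, l) \<in> consecutive_sums a (3 * N)"
      by (simp add: block_sum_def p_def)
  qed
  then have "card (block_sum N j ` blocks N) \<le> card (consecutive_sums a (3 * N))"
    by (intro card_mono finite_consecutive_sums)
  then have "N\<^sup>2 \<le> 66 * card (consecutive_sums a (3 * N))" using many by linarith
  ultimately show thesis by (rule that)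
qed

lemma exists_bounded_sequence_many_consecutive_sums:
  fixes n :: nat
  assumes "1 \<le> n"
  obtains k and a :: "nat \<Rightarrow> int" where
    "strict_mono_on {1..k} a" "\<forall>i \<in> {1..k}. 1 \<le> a i \<and> a i \<le> int n"
    "n\<^sup>2 \<le> 12\<^sup>2 * 66 * card (consecutive_sums a k)"
proof (cases "n < 6")
  case True
  have "n\<^sup>2 \<le> 6\<^sup>2" using True by (intro power_mono) auto
  then show thesis
    using assms by (intro that[of 1 "\<lambda>_. 1"]) (auto simp: consecutive_sums_Suc_0 strict_mono_on_def)
next
  case False
  define N where "N = n div 6"
  have N: "0 < N" "6 * N \<le> n" "n \<le> 12 * N" using False unfolding N_def by presburger+
  obtain a :: "nat \<Rightarrow> int" where a: "strict_mono a" "\<And>i. i \<in> {1..3 * N} \<Longrightarrow> a i \<in> {1..6 * int N}"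
    and many: "N\<^sup>2 \<le> 66 * card (consecutive_sums a (3 * N))"
    using exists_sequence_many_consecutive_sums[OF N(1)] by blast
  have "strict_mono_on {1..3 * N} a" using a(1) by (rule monotone_on_subset) simp
  moreover have "\<forall>i \<in> {1..3 * N}. 1 \<le> a i \<and> a i \<le> int n" using a(2) N(2) by fastforce
  moreover have "n\<^sup>2 \<le> (12 * N)\<^sup>2" using N(3) by (rule power_mono) simp
  then have "n\<^sup>2 \<le> 12\<^sup>2 * 66 * card (consecutive_sums a (3 * N))"
    using many by (simp add: power_mult_distrib)
  ultimately show thesis by (rule that)
qed

theorem theorem1p1:
  "\<exists>c\<^sub>1 :: real. c\<^sub>1 > 0 \<and>
     (\<forall>n :: nat. n \<ge> 1 \<longrightarrow>
       (\<exists>(k :: nat) (a :: nat \<Rightarrow> int).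
          strict_mono_on {1..k} a \<and>
          (\<forall>i \<in> {1..k}. 1 \<le> a i \<and> a i \<le> int n) \<and>
          real (card {\<Sum>i = u..v. a i | u v. 1 \<le> u \<and> u \<le> v \<and> v \<le> k}) \<ge> c\<^sub>1 * (real n)\<^sup>2))"
  unfolding consecutive_sums_def[symmetric]
proof (intro exI[of _ "1 / (12\<^sup>2 * 66)"] conjI allI impI)
  fix n :: nat assume "1 \<le> n"
  then obtain k and a :: "nat \<Rightarrow> int" where
    a: "strict_mono_on {1..k} a" "\<forall>i \<in> {1..k}. 1 \<le> a i \<and> a i \<le> int n"
    and many: "n\<^sup>2 \<le> 12\<^sup>2 * 66 * card (consecutive_sums a k)"
    by (rule exists_bounded_sequence_many_consecutive_sums)
  from many have "real (n\<^sup>2) \<le> real (12\<^sup>2 * 66 * card (consecutive_sums a k))"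
    by (simp only: of_nat_le_iff)
  then have "1 / (12\<^sup>2 * 66) * (real n)\<^sup>2 \<le> real (card (consecutive_sums a k))" by simp
  with a show "\<exists>k a. strict_mono_on {1..k} a \<and> (\<forall>i \<in> {1..k}. 1 \<le> a i \<and> a i \<le> int n) \<and>
      1 / (12\<^sup>2 * 66) * (real n)\<^sup>2 \<le> real (card (consecutive_sums a k))"
    by blast
qed simp

end
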